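(* Let $\beta>0$ and let $A\in\{a_\beta,b_\beta,c_\beta\}$. There exists $C_\beta>0$ depending only on $\beta$ and $\Omega$ such that $$|A(\boldsymbol{u},\boldsymbol{v})|\le C_\beta\,\|\boldsymbol{u}\|_U\|\boldsymbol{v}\|_U\qquad\text{for all }\boldsymbol{u},\boldsymbol{v}\in U .$$ If $\beta\ge1+C_F^2$, then $A$ is coercive, i.e., $$C\,\|\boldsymbol{u}\|_U^2\le A(\boldsymbol{u},\boldsymbol{u})\qquad\text{for all }\boldsymbol{u}\in U,$$ where the constant $C>0$ is independent of $\beta$ and $\Omega$.
   Context: $\Omega\subset\mathbb{R}^n$, $n\in\{2,3\}$, is a polygonal (polyhedral) bounded Lipschitz domain. $(\cdot,\cdot)$ and $\|\cdot\|$ are the $L^2(\Omega)$ (or $L^2(\Omega)^n$) inner product and norm. $H^{-1}(\Omega)$ is the dual of $H_0^1(\Omega)$, with duality $\langle\cdot,\cdot\rangle$ extending the $L^2(\Omega)$ inner product. The generalized divergence $\operatorname{div}:L^2(\Omega)^n\to H^{-1}(\Omega)$ is $\langle\operatorname{div}\boldsymbol{\sigma},v\rangle:=-(\boldsymbol{\sigma},\nabla v)$ for $v\in H_0^1(\Omega)$. $C_F=C_F(\Omega)$, $0<C_F\le\operatorname{diam}(\Omega)$, is the constant in Friedrichs' inequality $\|v\|\le C_F\|\nabla v\|$ for all $v\in H_0^1(\Omega)$. $U:=\{(u,\boldsymbol{\sigma},\lambda)\in H_0^1(\Omega)\times L^2(\Omega)^n\times H^{-1}(\Omega): \operatorname{div}\boldsymbol{\sigma}+\lambda\in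 L^2(\Omega)\}$ with norm $\|(u,\boldsymbol{\sigma},\lambda)\|_U^2:=\|\nabla u\|^2+\|\boldsymbol{\sigma}\|^2+\|\operatorname{div}\boldsymbol{\sigma}+\lambda\|^2$. For $\boldsymbol{u}=(u,\boldsymbol{\sigma},\lambda)$, $\boldsymbol{v}=(v,\boldsymbol{\tau},\mu)\in U$: $a_\beta(\boldsymbol{u},\boldsymbol{v}):=\beta(\operatorname{div}\boldsymbol{\sigma}+\lambda,\operatorname{div}\boldsymbol{\tau}+\mu)+(\nabla u-\boldsymbol{\sigma},\nabla v-\boldsymbol{\tau})+\tfrac12(\langle\mu,u\rangle+\langle\lambda,v\rangle)$, $b_\beta(\boldsymbol{u},\boldsymbol{v}):=\beta(\operatorname{div}\boldsymbol{\sigma}+\lambda,\operatorname{div}\boldsymbol{\tau}+\mu)+(\nabla u-\boldsymbol{\sigma},\nabla v-\boldsymbol{\tau})+\langle\lambda,v\rangle$, $c_\beta(\boldsymbol{u},\boldsymbol{v}):=\beta(\operatorname{div}\boldsymbol{\sigma}+\lambda,\operatorname{div}\boldsymbol{\tau}+\mu)+(\nabla u-\boldsymbol{\sigma},\nabla v-\boldsymbol{\tau})+\langle\mu,u\rangle$. *)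

theory Defs
  imports "HOL-Analysis.Analysis"
begin

section \<open>Polygonal and polyhedral Lipschitz domains\<close>

(* After shrinking V to a cylinder around x with axis e this is the usual local description of
   Omega as the strict epigraph of a Lipschitz function of the coordinates orthogonal to e. *)
definition lipschitz_boundary :: "'a::euclidean_space set \<Rightarrow> bool" where
  "lipschitz_boundary \<Omega> \<longleftrightarrow>
     (\<forall>x\<in>frontier \<Omega>. \<exists>V e L (\<gamma> :: 'a \<Rightarrow> real).
        open V \<and> x \<in> V \<and> norm e = 1 \<and> L-lipschitz_on {z. z \<bullet> e = 0} \<gamma> \<and>
        \<Omega> \<inter> V = {y \<in> V. \<gamma> (y - (y \<bullet> e) *\<^sub>R e) < y \<bullet> e})"

(* The library's polytopes are convex; general polygons and polyhedra are finite unions of them. *)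
definition polyhedral_lipschitz_domain :: "'a::euclidean_space set \<Rightarrow> bool" where
  "polyhedral_lipschitz_domain \<Omega> \<longleftrightarrow>
     open \<Omega> \<and> connected \<Omega> \<and> \<Omega> \<noteq> {} \<and> bounded \<Omega> \<and> lipschitz_boundary \<Omega> \<and>
     (\<exists>\<P>. finite \<P> \<and> (\<forall>P\<in>\<P>. polytope P) \<and> closure \<Omega> = \<Union>\<P>)"

section \<open>Square-integrable functions\<close>

(* Elements of the Lebesgue and Sobolev spaces are represented by functions on the whole space
   of which only the values on Omega matter; functions equal a.e. on Omega are not identified. *)
definition L2 :: "'a::euclidean_space set \<Rightarrow> ('a \<Rightarrow> 'b::euclidean_space) set" where
  "L2 \<Omega> = {f \<in> borel_measurable (lebesgue_on \<Omega>). integrable (lebesgue_on \<Omega>) (\<lambda>x. (norm (f x))\<^sup>2)}"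

definition L2_inner ::
  "'a::euclidean_space set \<Rightarrow> ('a \<Rightarrow> 'b::euclidean_space) \<Rightarrow> ('a \<Rightarrow> 'b) \<Rightarrow> real" where
  "L2_inner \<Omega> f g = (\<integral>x. f x \<bullet> g x \<partial>lebesgue_on \<Omega>)"

definition L2_norm :: "'a::euclidean_space set \<Rightarrow> ('a \<Rightarrow> 'b::euclidean_space) \<Rightarrow> real" where
  "L2_norm \<Omega> f = sqrt (L2_inner \<Omega> f f)"

section \<open>Test functions\<close>

definition partial_deriv :: "'a::euclidean_space \<Rightarrow> ('a \<Rightarrow> real) \<Rightarrow> 'a \<Rightarrow> real" where
  "partial_deriv i f x = frechet_derivative f (at x) i"

definition gradient :: "('a::euclidean_space \<Rightarrow> real) \<Rightarrow> 'a \<Rightarrow> 'a" where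
  "gradient f x = (\<Sum>i\<in>Basis. partial_deriv i f x *\<^sub>R i)"

primrec continuously_diff :: "nat \<Rightarrow> ('a::euclidean_space \<Rightarrow> real) \<Rightarrow> bool" where
  "continuously_diff 0 f \<longleftrightarrow> continuous_on UNIV f"
| "continuously_diff (Suc k) f \<longleftrightarrow>
     f differentiable_on UNIV \<and> (\<forall>i\<in>Basis. continuously_diff k (partial_deriv i f))"

definition test_functions :: "'a::euclidean_space set \<Rightarrow> ('a \<Rightarrow> real) set" where
  "test_functions \<Omega> = {\<phi>. (\<forall>k. continuously_diff k \<phi>) \<and>
     compact (closure {x. \<phi> x \<noteq> 0}) \<and> closure {x. \<phi> x \<noteq> 0} \<subseteq> \<Omega>}"

section \<open>Sobolev spaces\<close>

definition weak_gradient :: "'a::euclidean_space set \<Rightarrow> ('a \<Rightarrow> real) \<Rightarrow> ('a \<Rightarrow> 'a) \<Rightarrow> bool" where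
  "weak_gradient \<Omega> v g \<longleftrightarrow> g \<in> L2 \<Omega> \<and>
     (\<forall>\<phi>\<in>test_functions \<Omega>. \<forall>i\<in>Basis.
        L2_inner \<Omega> v (partial_deriv i \<phi>) = - L2_inner \<Omega> (\<lambda>x. g x \<bullet> i) \<phi>)"

definition H1 :: "'a::euclidean_space set \<Rightarrow> ('a \<Rightarrow> real) set" where
  "H1 \<Omega> = {v \<in> L2 \<Omega>. \<exists>g. weak_gradient \<Omega> v g}"

(* The weak gradient is unique up to null sets, so the choice of a representative is immaterial. *)
definition grad :: "'a::euclidean_space set \<Rightarrow> ('a \<Rightarrow> real) \<Rightarrow> 'a \<Rightarrow> 'a" where
  "grad \<Omega> v = (SOME g. weak_gradient \<Omega> v g)"

(* The closure of the test functions in the H1 norm. *)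
definition H10 :: "'a::euclidean_space set \<Rightarrow> ('a \<Rightarrow> real) set" where
  "H10 \<Omega> = {v \<in> H1 \<Omega>. \<forall>\<epsilon>>0. \<exists>\<phi>\<in>test_functions \<Omega>.
     (L2_norm \<Omega> (\<lambda>x. v x - \<phi> x))\<^sup>2 + (L2_norm \<Omega> (\<lambda>x. grad \<Omega> v x - gradient \<phi> x))\<^sup>2 < \<epsilon>}"

(* Values of a functional outside H10 are irrelevant.  Boundedness makes the functional
   respect equality almost everywhere. *)
definition Hm1 :: "'a::euclidean_space set \<Rightarrow> (('a \<Rightarrow> real) \<Rightarrow> real) set" where
  "Hm1 \<Omega> = {l.
     (\<forall>v\<in>H10 \<Omega>. \<forall>w\<in>H10 \<Omega>. l (\<lambda>x. v x + w x) = l v + l w) \<and>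
     (\<forall>v\<in>H10 \<Omega>. \<forall>c. l (\<lambda>x. c * v x) = c * l v) \<and>
     (\<exists>K. \<forall>v\<in>H10 \<Omega>. \<bar>l v\<bar> \<le> K * sqrt ((L2_norm \<Omega> v)\<^sup>2 + (L2_norm \<Omega> (grad \<Omega> v))\<^sup>2))}"

definition gen_div :: "'a::euclidean_space set \<Rightarrow> ('a \<Rightarrow> 'a) \<Rightarrow> ('a \<Rightarrow> real) \<Rightarrow> real" where
  "gen_div \<Omega> \<sigma> v = - L2_inner \<Omega> \<sigma> (grad \<Omega> v)"

(* An L2 function f is embedded into the dual of H10 as the functional mapping v to (f, v). *)
definition represents :: "'a::euclidean_space set \<Rightarrow> ('a \<Rightarrow> real) \<Rightarrow> (('a \<Rightarrow> real) \<Rightarrow> real) \<Rightarrow> bool" where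
  "represents \<Omega> f l \<longleftrightarrow> f \<in> L2 \<Omega> \<and> (\<forall>v\<in>H10 \<Omega>. l v = L2_inner \<Omega> f v)"

definition friedrichs_constant :: "'a::euclidean_space set \<Rightarrow> real \<Rightarrow> bool" where
  "friedrichs_constant \<Omega> C \<longleftrightarrow> 0 < C \<and> C \<le> diameter \<Omega> \<and>
     (\<forall>v\<in>H10 \<Omega>. L2_norm \<Omega> v \<le> C * L2_norm \<Omega> (grad \<Omega> v))"

section \<open>The space U and the bilinear forms\<close>

type_synonym 'a triple = "('a \<Rightarrow> real) \<times> ('a \<Rightarrow> 'a) \<times> (('a \<Rightarrow> real) \<Rightarrow> real)"

definition U :: "'a::euclidean_space set \<Rightarrow> 'a triple set" where
  "U \<Omega> = {(u, \<sigma>, l). u \<in> H10 \<Omega> \<and> \<sigma> \<in> L2 \<Omega> \<and> l \<in> Hm1 \<Omega> \<and>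
     (\<exists>f. represents \<Omega> f (\<lambda>v. gen_div \<Omega> \<sigma> v + l v))}"

(* div sigma + lambda as an L2 function, which is unique up to null sets for elements of U *)
definition div_plus :: "'a::euclidean_space set \<Rightarrow> ('a \<Rightarrow> 'a) \<Rightarrow> (('a \<Rightarrow> real) \<Rightarrow> real) \<Rightarrow> 'a \<Rightarrow> real" where
  "div_plus \<Omega> \<sigma> l = (SOME f. represents \<Omega> f (\<lambda>v. gen_div \<Omega> \<sigma> v + l v))"

definition U_norm :: "'a::euclidean_space set \<Rightarrow> 'a triple \<Rightarrow> real" where
  "U_norm \<Omega> = (\<lambda>(u, \<sigma>, l).
     sqrt ((L2_norm \<Omega> (grad \<Omega> u))\<^sup>2 + (L2_norm \<Omega> \<sigma>)\<^sup>2 + (L2_norm \<Omega> (div_plus \<Omega> \<sigma> l))\<^sup>2))"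

definition a_form :: "'a::euclidean_space set \<Rightarrow> real \<Rightarrow> 'a triple \<Rightarrow> 'a triple \<Rightarrow> real" where
  "a_form \<Omega> \<beta> = (\<lambda>(u, \<sigma>, l) (v, \<tau>, m).
     \<beta> * L2_inner \<Omega> (div_plus \<Omega> \<sigma> l) (div_plus \<Omega> \<tau> m) +
     L2_inner \<Omega> (\<lambda>x. grad \<Omega> u x - \<sigma> x) (\<lambda>x. grad \<Omega> v x - \<tau> x) +
     1 / 2 * (m u + l v))"

definition b_form :: "'a::euclidean_space set \<Rightarrow> real \<Rightarrow> 'a triple \<Rightarrow> 'a triple \<Rightarrow> real" where
  "b_form \<Omega> \<beta> = (\<lambda>(u, \<sigma>, l) (v, \<tau>, m).
     \<beta> * L2_inner \<Omega> (div_plus \<Omega> \<sigma> l) (div_plus \<Omega> \<tau> m) +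
     L2_inner \<Omega> (\<lambda>x. grad \<Omega> u x - \<sigma> x) (\<lambda>x. grad \<Omega> v x - \<tau> x) +
     l v)"

definition c_form :: "'a::euclidean_space set \<Rightarrow> real \<Rightarrow> 'a triple \<Rightarrow> 'a triple \<Rightarrow> real" where
  "c_form \<Omega> \<beta> = (\<lambda>(u, \<sigma>, l) (v, \<tau>, m).
     \<beta> * L2_inner \<Omega> (div_plus \<Omega> \<sigma> l) (div_plus \<Omega> \<tau> m) +
     L2_inner \<Omega> (\<lambda>x. grad \<Omega> u x - \<sigma> x) (\<lambda>x. grad \<Omega> v x - \<tau> x) +
     m u)"

end

theory Submission
  imports Defs
begin

text \<open>
  For \<open>(u, \<sigma>, l)\<close> in \<open>U\<close> the functional \<open>l\<close> acts on \<open>H10\<close> by \<open>l v = (f, v) + (\<sigma>, grad v)\<close>, where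
  \<open>f\<close> is the \<open>L2\<close> function \<open>div \<sigma> + l\<close>.  After this substitution every term of the three forms is
  an \<open>L2\<close> inner product, and boundedness is Cauchy-Schwarz once the factor \<open>norm v\<close>, which is not
  part of the norm of \<open>U\<close>, is controlled by \<open>norm (grad v)\<close> (\<open>U_functional_le\<close>, \<open>forms_bounded\<close>).

  On the diagonal the three forms coincide, and there
  \<open>norm (grad u - \<sigma>)^2 + (\<sigma>, grad u) = norm (grad u)^2 - (\<sigma>, grad u) + norm \<sigma>^2\<close> is at least half of
  \<open>norm (grad u)^2 + norm \<sigma>^2\<close>.  The remaining indefinite term \<open>(f, u)\<close> is absorbed by Young's inequality
  \<open>norm f * C * norm (grad u) \<le> C^2 * norm f^2 + norm (grad u)^2 / 4\<close>, where \<open>C\<close> is the Friedrichs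
  constant; the condition on \<open>\<beta>\<close> leaves \<open>norm f^2\<close> with a coefficient of at least 1.  The resulting
  coercivity constant is 1/4 (\<open>forms_coercive\<close>).

  Friedrichs' inequality has to be proved for the boundedness part.  It comes from the
  definition of the weak gradient alone, without any integration by parts or Fubini argument:
  if \<open>\<phi>\<close> is a test function, then so is \<open>x\<^sub>i \<phi>\<close>, whose \<open>i\<close>-th partial derivative is
  \<open>\<phi> + x\<^sub>i \<partial>\<^sub>i\<phi>\<close>.  Testing the weak gradient of \<open>v\<close> with it gives
  \<open>(v, \<phi>) = - (x\<^sub>i v, \<partial>\<^sub>i\<phi>) - (\<partial>\<^sub>iv, x\<^sub>i \<phi>)\<close>, and as \<open>\<phi>\<close> tends to \<open>v\<close> in \<open>H1\<close>, this yields
  \<open>norm v^2 \<le> 2 R * norm v * norm (grad v)\<close> on a domain contained in the ball of radius \<open>R\<close>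
  (\<open>H10_inner_test_function_le\<close>, \<open>H10_Friedrichs\<close>).
\<close>

section \<open>Inner product and norm on square-integrable functions\<close>

text \<open>
  The types of \<open>f\<close> and \<open>h\<close> may differ, so that this covers a component of a vector field, the
  product with a coordinate on a bounded domain, and bounded functions compared with a constant.
\<close>

lemma L2_dominated:
  fixes f :: "'a::euclidean_space \<Rightarrow> 'b::euclidean_space"
    and h :: "'a \<Rightarrow> 'c::euclidean_space"
  assumes f: "f \<in> L2 \<Omega>" and h: "h \<in> borel_measurable (lebesgue_on \<Omega>)"
    and K: "0 \<le> K" and le: "\<And>x. x \<in> \<Omega> \<Longrightarrow> norm (h x) \<le> K * norm (f x)"
  shows "h \<in> L2 \<Omega>" and "L2_norm \<Omega> h \<le> K * L2_norm \<Omega> f"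
proof -
  have fi: "integrable (lebesgue_on \<Omega>) (\<lambda>x. K\<^sup>2 * (norm (f x))\<^sup>2)"
    using f by (simp add: L2_def)
  have sq: "(norm (h x))\<^sup>2 \<le> K\<^sup>2 * (norm (f x))\<^sup>2" if "x \<in> \<Omega>" for x
    using power_mono[OF le[OF that], of 2] by (simp add: power_mult_distrib)
  have hi: "integrable (lebesgue_on \<Omega>) (\<lambda>x. (norm (h x))\<^sup>2)"
  proof (rule Bochner_Integration.integrable_bound[OF fi])
    show "(\<lambda>x. (norm (h x))\<^sup>2) \<in> borel_measurable (lebesgue_on \<Omega>)"
      using h by measurable
    show "AE x in lebesgue_on \<Omega>. norm ((norm (h x))\<^sup>2) \<le> norm (K\<^sup>2 * (norm (f x))\<^sup>2)"
      by (rule AE_I2) (use sq in \<open>auto simp: space_restrict_space abs_mult\<close>)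
  qed
  show "h \<in> L2 \<Omega>" using h hi by (simp add: L2_def)
  have "L2_inner \<Omega> h h \<le> K\<^sup>2 * L2_inner \<Omega> f f"
    unfolding L2_inner_def power2_norm_eq_inner[symmetric] integral_mult_right_zero[symmetric]
    by (rule integral_mono[OF hi fi]) (use sq in \<open>auto simp: space_restrict_space\<close>)
  then have "L2_norm \<Omega> h \<le> sqrt (K\<^sup>2 * L2_inner \<Omega> f f)"
    by (simp add: L2_norm_def)
  then show "L2_norm \<Omega> h \<le> K * L2_norm \<Omega> f"
    using K by (simp add: L2_norm_def real_sqrt_mult)
qed

lemma L2_inner_integrable:
  assumes f: "f \<in> L2 \<Omega>" and g: "g \<in> L2 \<Omega>"
  shows "integrable (lebesgue_on \<Omega>) (\<lambda>x. f x \<bullet> g x)"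
proof (rule Bochner_Integration.integrable_bound)
  show "integrable (lebesgue_on \<Omega>) (\<lambda>x. (norm (f x))\<^sup>2 + (norm (g x))\<^sup>2)"
    using f g by (simp add: L2_def)
  show "(\<lambda>x. f x \<bullet> g x) \<in> borel_measurable (lebesgue_on \<Omega>)"
    using f g by (auto simp: L2_def)
  have "\<bar>x \<bullet> y\<bar> \<le> (norm x)\<^sup>2 + (norm y)\<^sup>2" for x y :: 'b
  proof -
    have "2 * (norm x * norm y) \<le> (norm x)\<^sup>2 + (norm y)\<^sup>2"
      using sum_squares_bound[of "norm x" "norm y"] by simp
    moreover have "0 \<le> norm x * norm y" by simp
    ultimately show ?thesis
      using Cauchy_Schwarz_ineq2[of x y] by linarith
  qed
  then show "AE x in lebesgue_on \<Omega>. norm (f x \<bullet> g x) \<le> norm ((norm (f x))\<^sup>2 + (norm (g x))\<^sup>2)"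
    by simp
qed

lemma L2_diff:
  assumes f: "f \<in> L2 \<Omega>" and g: "g \<in> L2 \<Omega>"
  shows "(\<lambda>x. f x - g x) \<in> L2 \<Omega>"
proof -
  have "(norm (f x - g x))\<^sup>2 = (norm (f x))\<^sup>2 + (norm (g x))\<^sup>2 - 2 * (f x \<bullet> g x)" for x
    by (simp add: power2_norm_eq_inner inner_diff inner_commute)
  then show ?thesis
    using f g L2_inner_integrable[OF f g] by (auto simp: L2_def)
qed

lemma L2_scaleR: "f \<in> L2 \<Omega> \<Longrightarrow> (\<lambda>x. c *\<^sub>R f x) \<in> L2 \<Omega>"
  by (auto simp: L2_def power_mult_distrib)

lemma L2_inner_commute: "L2_inner \<Omega> f g = L2_inner \<Omega> g f"
  by (simp add: L2_inner_def inner_commute)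

lemma L2_inner_diff_left:
  assumes "f \<in> L2 \<Omega>" "g \<in> L2 \<Omega>" "h \<in> L2 \<Omega>"
  shows "L2_inner \<Omega> (\<lambda>x. f x - g x) h = L2_inner \<Omega> f h - L2_inner \<Omega> g h"
  using assms by (simp add: L2_inner_def inner_diff_left L2_inner_integrable)

lemma L2_inner_diff_right:
  assumes "f \<in> L2 \<Omega>" "g \<in> L2 \<Omega>" "h \<in> L2 \<Omega>"
  shows "L2_inner \<Omega> h (\<lambda>x. f x - g x) = L2_inner \<Omega> h f - L2_inner \<Omega> h g"
  using assms by (simp add: L2_inner_def inner_diff_right L2_inner_integrable)

lemma L2_inner_nonneg: "0 \<le> L2_inner \<Omega> f f"
  by (simp add: L2_inner_def)

lemma L2_norm_nonneg: "0 \<le> L2_norm \<Omega> f"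
  by (simp add: L2_norm_def L2_inner_nonneg)

lemma L2_norm_power2: "(L2_norm \<Omega> f)\<^sup>2 = L2_inner \<Omega> f f"
  by (simp add: L2_norm_def L2_inner_nonneg)

lemma L2_norm_diff_power2:
  assumes f: "f \<in> L2 \<Omega>" and g: "g \<in> L2 \<Omega>"
  shows "(L2_norm \<Omega> (\<lambda>x. f x - g x))\<^sup>2
    = (L2_norm \<Omega> f)\<^sup>2 - 2 * L2_inner \<Omega> f g + (L2_norm \<Omega> g)\<^sup>2"
  using L2_diff[OF f g] f g
  by (simp add: L2_norm_power2 L2_inner_diff_left L2_inner_diff_right L2_inner_commute[of \<Omega> g f])

lemma L2_Cauchy_Schwarz:
  assumes f: "f \<in> L2 \<Omega>" and g: "g \<in> L2 \<Omega>"
  shows "\<bar>L2_inner \<Omega> f g\<bar> \<le> L2_norm \<Omega> f * L2_norm \<Omega> g"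
proof -
  define a b c where "a = (L2_norm \<Omega> f)\<^sup>2" and "b = (L2_norm \<Omega> g)\<^sup>2" and "c = L2_inner \<Omega> f g"
  have q: "0 \<le> a - 2 * t * c + t\<^sup>2 * b" for t
  proof -
    have "0 \<le> (L2_norm \<Omega> (\<lambda>x. f x - t *\<^sub>R g x))\<^sup>2"
      by simp
    also have "\<dots> = a - 2 * t * c + t\<^sup>2 * b"
      unfolding L2_norm_diff_power2[OF f L2_scaleR[OF g]]
      unfolding a_def b_def c_def L2_norm_power2
      by (simp add: L2_inner_def power2_eq_square mult_ac)
    finally show ?thesis .
  qed
  have "c\<^sup>2 \<le> a * b"
  proof (cases "b = 0")
    case True
    \<comment> \<open>The quadratic is then affine in \<open>t\<close>; a nonzero slope would make it \<open>-1\<close> at this point.\<close>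
    have "c = 0"
    proof (rule ccontr)
      assume "c \<noteq> 0"
      then have "a - 2 * ((a + 1) / (2 * c)) * c = -1"
        by (simp add: field_simps)
      then show False using q[of "(a + 1) / (2 * c)"] True by simp
    qed
    then show ?thesis using True by simp
  next
    case False
    then have "b > 0" by (simp add: b_def)
    have "0 \<le> a - 2 * (c / b) * c + (c / b)\<^sup>2 * b" by (rule q)
    also have "\<dots> = a - c\<^sup>2 / b"
      using \<open>b > 0\<close> by (simp add: power2_eq_square field_simps)
    finally show ?thesis using \<open>b > 0\<close> by (simp add: field_simps)
  qed
  then have "\<bar>c\<bar> \<le> sqrt (a * b)"
    using real_le_rsqrt[of "\<bar>c\<bar>"] by simp
  then show ?thesis
    by (simp add: a_def b_def c_def real_sqrt_mult L2_norm_nonneg)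
qed

lemma L2_norm_diff_le:
  assumes f: "f \<in> L2 \<Omega>" and g: "g \<in> L2 \<Omega>"
  shows "L2_norm \<Omega> (\<lambda>x. f x - g x) \<le> L2_norm \<Omega> f + L2_norm \<Omega> g"
proof (rule power2_le_imp_le)
  show "(L2_norm \<Omega> (\<lambda>x. f x - g x))\<^sup>2 \<le> (L2_norm \<Omega> f + L2_norm \<Omega> g)\<^sup>2"
    using L2_Cauchy_Schwarz[OF f g] unfolding L2_norm_diff_power2[OF f g] power2_sum by linarith
qed (simp add: L2_norm_nonneg)

lemma L2_norm_le_approx:
  assumes f: "f \<in> L2 \<Omega>" and g: "g \<in> L2 \<Omega>"
  shows "L2_norm \<Omega> g \<le> L2_norm \<Omega> f + L2_norm \<Omega> (\<lambda>x. f x - g x)"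
  using L2_norm_diff_le[OF f L2_diff[OF f g]] by simp

lemma continuous_imp_L2:
  fixes f :: "'a::euclidean_space \<Rightarrow> 'b::euclidean_space"
  assumes "bounded \<Omega>" "open \<Omega>" and f: "continuous_on UNIV f"
  shows "f \<in> L2 \<Omega>"
proof -
  have lm: "\<Omega> \<in> lmeasurable"
    using assms by (simp add: bounded_set_imp_lmeasurable)
  have "compact (f ` closure \<Omega>)"
    using assms by (intro compact_continuous_image) (auto intro: continuous_on_subset)
  then obtain B where B: "\<And>x. x \<in> \<Omega> \<Longrightarrow> norm (f x) \<le> B"
    using compact_imp_bounded bounded_iff closure_subset by (metis imageI subsetD)
  show ?thesis
  proof (rule L2_dominated(1))
    interpret finite_measure "lebesgue_on \<Omega>"
      using lm by (rule finite_measure_lebesgue_on)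
    show "(\<lambda>_. 1::real) \<in> L2 \<Omega>" by (simp add: L2_def)
    show "f \<in> borel_measurable (lebesgue_on \<Omega>)"
      using f lm by (intro continuous_imp_measurable_on_sets_lebesgue)
        (auto intro: continuous_on_subset fmeasurableD)
    show "norm (f x) \<le> max B 0 * norm (1::real)" if "x \<in> \<Omega>" for x
      using B[OF that] by simp
  qed simp
qed

section \<open>Test functions multiplied by a coordinate\<close>

lemma partial_deriv_eqI:
  assumes "(f has_derivative D) (at x)"
  shows "partial_deriv i f x = D i"
  using frechet_derivative_at[OF assms] by (simp add: partial_deriv_def)

lemma has_derivative_frechet:
  assumes "f differentiable_on UNIV"
  shows "(f has_derivative frechet_derivative f (at x)) (at x)"
  using assms by (simp add: differentiable_on_def frechet_derivative_works)

lemma continuously_diff_SucD: "continuously_diff (Suc k) f \<Longrightarrow> continuously_diff k f"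
  by (induction k arbitrary: f) (auto intro: differentiable_imp_continuous_on)

lemma continuously_diff_mult_add:
  "continuously_diff k f \<Longrightarrow> continuously_diff k g \<Longrightarrow> continuously_diff k (\<lambda>x. c * f x + g x)"
proof (induction k arbitrary: f g)
  case 0
  then show ?case by (auto intro!: continuous_intros)
next
  case (Suc k)
  then have f: "f differentiable_on UNIV" and g: "g differentiable_on UNIV" by auto
  have "partial_deriv i (\<lambda>x. c * f x + g x) = (\<lambda>x. c * partial_deriv i f x + partial_deriv i g x)" for i
    by (rule ext, rule trans, rule partial_deriv_eqI)
       (auto intro!: derivative_eq_intros has_derivative_frechet f g simp: partial_deriv_def)
  with Suc f g show ?case by auto
qed

lemma partial_deriv_coordinate_mult:
  assumes "f differentiable_on UNIV"
  shows "partial_deriv j (\<lambda>x. (x \<bullet> i) * f x) = (\<lambda>x. (j \<bullet> i) * f x + (x \<bullet> i) * partial_deriv j f x)"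
  by (rule ext, rule trans, rule partial_deriv_eqI)
     (auto intro!: derivative_eq_intros has_derivative_frechet assms simp: partial_deriv_def)

lemma continuously_diff_coordinate_mult:
  "continuously_diff k f \<Longrightarrow> continuously_diff k (\<lambda>x. (x \<bullet> i) * f x)"
proof (induction k arbitrary: f)
  case 0
  then show ?case by (auto intro!: continuous_intros)
next
  case (Suc k)
  then have f: "f differentiable_on UNIV" by auto
  have "(\<lambda>x. (x \<bullet> i) * f x) differentiable_on UNIV"
    using f by (auto intro!: derivative_intros simp: differentiable_on_def)
  with Suc f continuously_diff_SucD[OF Suc.prems] show ?case
    by (auto simp: partial_deriv_coordinate_mult intro!: continuously_diff_mult_add)
qed

lemma test_function_coordinate_mult:
  assumes "\<phi> \<in> test_functions \<Omega>"
  shows "(\<lambda>x. (x \<bullet> i) * \<phi> x) \<in> test_functions \<Omega>"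
proof -
  have "closure {x. (x \<bullet> i) * \<phi> x \<noteq> 0} \<subseteq> closure {x. \<phi> x \<noteq> 0}"
    by (rule closure_mono) auto
  moreover from this have "compact (closure {x. (x \<bullet> i) * \<phi> x \<noteq> 0})"
    using assms unfolding test_functions_def
    by (metis (mono_tags, lifting) mem_Collect_eq bounded_subset compact_eq_bounded_closed closed_closure)
  ultimately show ?thesis
    using assms continuously_diff_coordinate_mult unfolding test_functions_def by blast
qed

lemma test_function_differentiable:
  assumes "\<phi> \<in> test_functions \<Omega>"
  shows "\<phi> differentiable_on UNIV"
  using assms continuously_diff.simps(2)[of 0 \<phi>] by (auto simp: test_functions_def)

lemma continuous_on_partial_deriv_test_function:
  assumes "\<phi> \<in> test_functions \<Omega>" "i \<in> Basis"
  shows "continuous_on UNIV (partial_deriv i \<phi>)"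
proof -
  have "continuously_diff (Suc 0) \<phi>" using assms by (simp add: test_functions_def)
  then show ?thesis using assms by simp
qed

lemma continuous_on_gradient_test_function:
  assumes "\<phi> \<in> test_functions \<Omega>"
  shows "continuous_on UNIV (gradient \<phi>)"
  unfolding gradient_def[abs_def]
  by (intro continuous_on_sum continuous_on_scaleR continuous_on_const
      continuous_on_partial_deriv_test_function[OF assms])

lemma gradient_inner_Basis: "i \<in> Basis \<Longrightarrow> gradient f x \<bullet> i = partial_deriv i f x"
  by (simp add: gradient_def inner_sum_left inner_Basis if_distrib cong: if_cong)

section \<open>Friedrichs' inequality\<close>

lemma weak_gradient_grad:
  assumes "v \<in> H10 \<Omega>"
  shows "weak_gradient \<Omega> v (grad \<Omega> v)"
proof -
  have "\<exists>g. weak_gradient \<Omega> v g" using assms by (simp add: H10_def H1_def)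
  then show ?thesis unfolding grad_def by (rule someI_ex)
qed

lemma H10_L2: "v \<in> H10 \<Omega> \<Longrightarrow> v \<in> L2 \<Omega>"
  by (simp add: H10_def H1_def)

lemma grad_L2: "v \<in> H10 \<Omega> \<Longrightarrow> grad \<Omega> v \<in> L2 \<Omega>"
  using weak_gradient_grad by (auto simp: weak_gradient_def)

text \<open>
  The inequality obtained by testing with \<open>x\<^sub>i \<phi>\<close>; letting \<open>\<phi>\<close> tend to \<open>v\<close> turns it into
  Friedrichs' inequality.
\<close>

lemma H10_inner_test_function_le:
  fixes \<Omega> :: "'a::euclidean_space set"
  assumes bd: "bounded \<Omega>" and op: "open \<Omega>" and R: "0 \<le> R" "\<And>x. x \<in> \<Omega> \<Longrightarrow> norm x \<le> R"
    and v: "v \<in> H10 \<Omega>" and phi: "\<phi> \<in> test_functions \<Omega>"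
  shows "\<bar>L2_inner \<Omega> v \<phi>\<bar> \<le> R * L2_norm \<Omega> v * L2_norm \<Omega> (gradient \<phi>)
    + R * L2_norm \<Omega> (grad \<Omega> v) * L2_norm \<Omega> \<phi>"
proof -
  obtain i :: 'a where i: "i \<in> Basis" using nonempty_Basis by blast
  note d = test_function_differentiable[OF phi]
  have vL: "v \<in> L2 \<Omega>" and gL: "grad \<Omega> v \<in> L2 \<Omega>" using v by (auto intro: H10_L2 grad_L2)
  have pL: "\<phi> \<in> L2 \<Omega>" and dL: "partial_deriv i \<phi> \<in> L2 \<Omega>" and GL: "gradient \<phi> \<in> L2 \<Omega>"
    using continuous_on_partial_deriv_test_function[OF phi] differentiable_imp_continuous_on[OF d] i
    by (auto intro!: continuous_imp_L2[OF bd op] continuous_on_gradient_test_function[OF phi])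
  have xm: "(\<lambda>x. x \<bullet> i) \<in> borel_measurable (lebesgue_on \<Omega>)"
    using op by (intro continuous_imp_measurable_on_sets_lebesgue) (auto intro!: continuous_intros)
  have xR: "\<bar>x \<bullet> i\<bar> \<le> R" if "x \<in> \<Omega>" for x
    using R(2)[OF that] Basis_le_norm[OF i, of x] by simp
  have xp: "(\<lambda>x. (x \<bullet> i) * \<phi> x) \<in> L2 \<Omega>" "L2_norm \<Omega> (\<lambda>x. (x \<bullet> i) * \<phi> x) \<le> R * L2_norm \<Omega> \<phi>"
    by (rule L2_dominated[OF pL _ R(1)];
        use pL xm xR in \<open>auto simp: L2_def abs_mult intro!: borel_measurable_times mult_right_mono\<close>)+
  have xv: "(\<lambda>x. (x \<bullet> i) * v x) \<in> L2 \<Omega>" "L2_norm \<Omega> (\<lambda>x. (x \<bullet> i) * v x) \<le> R * L2_norm \<Omega> v"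
    by (rule L2_dominated[OF vL _ R(1)];
        use vL xm xR in \<open>auto simp: L2_def abs_mult intro!: borel_measurable_times mult_right_mono\<close>)+
  have gi: "(\<lambda>x. grad \<Omega> v x \<bullet> i) \<in> L2 \<Omega>" "L2_norm \<Omega> (\<lambda>x. grad \<Omega> v x \<bullet> i) \<le> 1 * L2_norm \<Omega> (grad \<Omega> v)"
    by (rule L2_dominated[OF gL, where K = 1];
        use gL i in \<open>auto simp: L2_def Basis_le_norm\<close>)+
  have di: "L2_norm \<Omega> (partial_deriv i \<phi>) \<le> 1 * L2_norm \<Omega> (gradient \<phi>)"
    by (rule L2_dominated[OF GL, where K = 1];
        use dL i in \<open>auto simp: L2_def Basis_le_norm gradient_inner_Basis[symmetric]\<close>)
  have dx: "partial_deriv i (\<lambda>x. (x \<bullet> i) * \<phi> x) = (\<lambda>x. \<phi> x + (x \<bullet> i) * partial_deriv i \<phi> x)"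
    using i by (simp add: partial_deriv_coordinate_mult[OF d])
  have "L2_inner \<Omega> v \<phi> + L2_inner \<Omega> (\<lambda>x. (x \<bullet> i) * v x) (partial_deriv i \<phi>)
      = L2_inner \<Omega> v (partial_deriv i (\<lambda>x. (x \<bullet> i) * \<phi> x))"
    using L2_inner_integrable[OF vL pL] L2_inner_integrable[OF xv(1) dL]
    unfolding dx L2_inner_def
    by (subst Bochner_Integration.integral_add[symmetric]) (simp_all add: algebra_simps)
  also have "\<dots> = - L2_inner \<Omega> (\<lambda>x. grad \<Omega> v x \<bullet> i) (\<lambda>x. (x \<bullet> i) * \<phi> x)"
    using weak_gradient_grad[OF v] test_function_coordinate_mult[OF phi] i
    unfolding weak_gradient_def by blast
  finally have "\<bar>L2_inner \<Omega> v \<phi>\<bar> \<le> \<bar>L2_inner \<Omega> (\<lambda>x. (x \<bullet> i) * v x) (partial_deriv i \<phi>)\<bar>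
      + \<bar>L2_inner \<Omega> (\<lambda>x. grad \<Omega> v x \<bullet> i) (\<lambda>x. (x \<bullet> i) * \<phi> x)\<bar>"
    by linarith
  also have "\<dots> \<le> (R * L2_norm \<Omega> v) * (1 * L2_norm \<Omega> (gradient \<phi>))
      + (1 * L2_norm \<Omega> (grad \<Omega> v)) * (R * L2_norm \<Omega> \<phi>)"
    using R(1)
    by (intro add_mono order_trans[OF L2_Cauchy_Schwarz] mult_mono xp xv gi di dL
        mult_nonneg_nonneg L2_norm_nonneg) auto
  finally show ?thesis by (simp add: mult_ac)
qed

theorem H10_Friedrichs:
  fixes \<Omega> :: "'a::euclidean_space set"
  assumes bd: "bounded \<Omega>" and op: "open \<Omega>" and R: "0 \<le> R" "\<And>x. x \<in> \<Omega> \<Longrightarrow> norm x \<le> R"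
    and v: "v \<in> H10 \<Omega>"
  shows "L2_norm \<Omega> v \<le> 2 * R * L2_norm \<Omega> (grad \<Omega> v)"
proof -
  define N G where "N = L2_norm \<Omega> v" and "G = L2_norm \<Omega> (grad \<Omega> v)"
  have NG: "0 \<le> N" "0 \<le> G" by (simp_all add: N_def G_def L2_norm_nonneg)
  have vL: "v \<in> L2 \<Omega>" and gL: "grad \<Omega> v \<in> L2 \<Omega>" using v by (auto intro: H10_L2 grad_L2)
  \<comment> \<open>Passing to the limit along test functions, with all errors collected in a multiple of \<open>\<eta>\<close>.\<close>
  have approx: "N\<^sup>2 \<le> 2 * R * N * G + \<eta> * (N + R * N + R * G)" if "\<eta> > 0" for \<eta>
  proof -
    have "0 < \<eta>\<^sup>2" using that by simp
    then obtain \<phi> where phi: "\<phi> \<in> test_functions \<Omega>" and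
      lt: "(L2_norm \<Omega> (\<lambda>x. v x - \<phi> x))\<^sup>2 + (L2_norm \<Omega> (\<lambda>x. grad \<Omega> v x - gradient \<phi> x))\<^sup>2 < \<eta>\<^sup>2"
      using v unfolding H10_def by blast
    have pL: "\<phi> \<in> L2 \<Omega>" and GL: "gradient \<phi> \<in> L2 \<Omega>"
      using differentiable_imp_continuous_on[OF test_function_differentiable[OF phi]]
      by (auto intro!: continuous_imp_L2[OF bd op] continuous_on_gradient_test_function[OF phi])
    have "(L2_norm \<Omega> (\<lambda>x. v x - \<phi> x))\<^sup>2 \<le> \<eta>\<^sup>2"
      and "(L2_norm \<Omega> (\<lambda>x. grad \<Omega> v x - gradient \<phi> x))\<^sup>2 \<le> \<eta>\<^sup>2"
      using lt zero_le_power2[of "L2_norm \<Omega> (\<lambda>x. v x - \<phi> x)"]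
        zero_le_power2[of "L2_norm \<Omega> (\<lambda>x. grad \<Omega> v x - gradient \<phi> x)"] by linarith+
    then have e1: "L2_norm \<Omega> (\<lambda>x. v x - \<phi> x) \<le> \<eta>"
      and e2: "L2_norm \<Omega> (\<lambda>x. grad \<Omega> v x - gradient \<phi> x) \<le> \<eta>"
      using that by (auto intro: power2_le_imp_le)
    have n1: "L2_norm \<Omega> \<phi> \<le> N + \<eta>" and n2: "L2_norm \<Omega> (gradient \<phi>) \<le> G + \<eta>"
      using L2_norm_le_approx[OF vL pL] L2_norm_le_approx[OF gL GL] e1 e2
      by (simp_all add: N_def G_def)
    have "N\<^sup>2 = L2_inner \<Omega> v (\<lambda>x. v x - \<phi> x) + L2_inner \<Omega> v \<phi>"
      by (simp add: N_def L2_norm_power2 L2_inner_diff_right vL pL)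
    also have "\<dots> \<le> N * \<eta> + (R * N * (G + \<eta>) + R * G * (N + \<eta>))"
    proof (rule add_mono)
      have "L2_inner \<Omega> v (\<lambda>x. v x - \<phi> x) \<le> N * L2_norm \<Omega> (\<lambda>x. v x - \<phi> x)"
        using L2_Cauchy_Schwarz[OF vL L2_diff[OF vL pL]] by (simp add: N_def)
      also have "\<dots> \<le> N * \<eta>" using e1 NG(1) by (rule mult_left_mono)
      finally show "L2_inner \<Omega> v (\<lambda>x. v x - \<phi> x) \<le> N * \<eta>" .
      have "L2_inner \<Omega> v \<phi> \<le> R * N * L2_norm \<Omega> (gradient \<phi>) + R * G * L2_norm \<Omega> \<phi>"
        using H10_inner_test_function_le[OF bd op R v phi] by (simp add: N_def G_def)
      also have "\<dots> \<le> R * N * (G + \<eta>) + R * G * (N + \<eta>)"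
        using n1 n2 NG R by (intro add_mono mult_left_mono) auto
      finally show "L2_inner \<Omega> v \<phi> \<le> R * N * (G + \<eta>) + R * G * (N + \<eta>)" .
    qed
    finally show ?thesis by (simp add: algebra_simps)
  qed
  have "N\<^sup>2 \<le> 2 * R * N * G"
  proof (rule field_le_epsilon)
    fix e :: real assume "e > 0"
    define S where "S = N + R * N + R * G"
    have "S \<ge> 0" using NG R by (simp add: S_def)
    have "e / (S + 1) > 0" using \<open>e > 0\<close> \<open>S \<ge> 0\<close> by simp
    from approx[OF this] have "N\<^sup>2 \<le> 2 * R * N * G + e / (S + 1) * S"
      by (simp only: S_def)
    also have "e / (S + 1) * S \<le> e"
      using \<open>e > 0\<close> \<open>S \<ge> 0\<close> by (simp add: field_simps)
    finally show "N\<^sup>2 \<le> 2 * R * N * G + e" by simp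
  qed
  then have "N * N \<le> N * (2 * R * G)" by (simp add: power2_eq_square mult_ac)
  then have "N \<le> 2 * R * G"
    using NG R(1) by (cases "N = 0") simp_all
  then show ?thesis by (simp add: N_def G_def)
qed

section \<open>Estimates for the bilinear forms\<close>

lemma div_plus_represents:
  assumes "(u, \<sigma>, l) \<in> U \<Omega>"
  shows "represents \<Omega> (div_plus \<Omega> \<sigma> l) (\<lambda>v. gen_div \<Omega> \<sigma> v + l v)"
proof -
  have "\<exists>f. represents \<Omega> f (\<lambda>v. gen_div \<Omega> \<sigma> v + l v)" using assms by (simp add: U_def)
  then show ?thesis unfolding div_plus_def by (rule someI_ex)
qed

text \<open>
  Since \<open>div_plus\<close> represents the functional \<open>gen_div \<Omega> \<sigma> + l\<close> on \<open>H10\<close>, the duality terms of the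
  forms become \<open>L2\<close> inner products.
\<close>

lemma U_functional_eq:
  assumes "(u, \<sigma>, l) \<in> U \<Omega>" "v \<in> H10 \<Omega>"
  shows "l v = L2_inner \<Omega> (div_plus \<Omega> \<sigma> l) v + L2_inner \<Omega> \<sigma> (grad \<Omega> v)"
  using div_plus_represents[OF assms(1)] assms(2) by (auto simp: represents_def gen_div_def)

lemma U_memberD:
  assumes "(u, \<sigma>, l) \<in> U \<Omega>"
  shows "u \<in> H10 \<Omega>" "u \<in> L2 \<Omega>" "grad \<Omega> u \<in> L2 \<Omega>" "\<sigma> \<in> L2 \<Omega>" "div_plus \<Omega> \<sigma> l \<in> L2 \<Omega>"
  using assms div_plus_represents[OF assms]
  by (auto simp: U_def represents_def intro: H10_L2 grad_L2)

lemma U_norm_component_le: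
  "L2_norm \<Omega> (grad \<Omega> u) \<le> U_norm \<Omega> (u, \<sigma>, l)"
  "L2_norm \<Omega> \<sigma> \<le> U_norm \<Omega> (u, \<sigma>, l)"
  "L2_norm \<Omega> (div_plus \<Omega> \<sigma> l) \<le> U_norm \<Omega> (u, \<sigma>, l)"
  by (auto simp: U_norm_def intro!: real_le_rsqrt)

lemma U_norm_nonneg: "0 \<le> U_norm \<Omega> w"
  by (cases w) (simp add: U_norm_def)

lemma U_functional_le:
  assumes F: "\<And>v. v \<in> H10 \<Omega> \<Longrightarrow> L2_norm \<Omega> v \<le> K * L2_norm \<Omega> (grad \<Omega> v)" and K: "0 \<le> K"
    and s: "(u, \<sigma>, l) \<in> U \<Omega>" and t: "(v, \<tau>, m) \<in> U \<Omega>"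
  shows "\<bar>l v\<bar> \<le> (K + 1) * (U_norm \<Omega> (u, \<sigma>, l) * U_norm \<Omega> (v, \<tau>, m))"
proof -
  let ?X = "U_norm \<Omega> (u, \<sigma>, l)" and ?Y = "U_norm \<Omega> (v, \<tau>, m)"
  note sL = U_memberD[OF s] and tL = U_memberD[OF t]
  have "L2_norm \<Omega> v \<le> K * ?Y"
    using F[OF tL(1)] mult_left_mono[OF U_norm_component_le(1) K, of \<Omega> v \<tau> m] by linarith
  then have "\<bar>L2_inner \<Omega> (div_plus \<Omega> \<sigma> l) v\<bar> \<le> ?X * (K * ?Y)"
    using sL tL by (intro order_trans[OF L2_Cauchy_Schwarz] mult_mono U_norm_component_le
        L2_norm_nonneg U_norm_nonneg)
  moreover have "\<bar>L2_inner \<Omega> \<sigma> (grad \<Omega> v)\<bar> \<le> ?X * ?Y"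
    using sL tL by (intro order_trans[OF L2_Cauchy_Schwarz] mult_mono U_norm_component_le
        L2_norm_nonneg U_norm_nonneg)
  ultimately show ?thesis
    unfolding U_functional_eq[OF s tL(1)] by (simp add: algebra_simps)
qed

theorem forms_bounded:
  fixes \<Omega> :: "'a::euclidean_space set"
  assumes F: "\<And>v. v \<in> H10 \<Omega> \<Longrightarrow> L2_norm \<Omega> v \<le> K * L2_norm \<Omega> (grad \<Omega> v)" and K: "0 \<le> K"
    and \<beta>: "0 < \<beta>" and A: "A \<in> {a_form \<Omega> \<beta>, b_form \<Omega> \<beta>, c_form \<Omega> \<beta>}"
    and uU: "w \<in> U \<Omega>" and vU: "z \<in> U \<Omega>"
  shows "\<bar>A w z\<bar> \<le> (\<beta> + K + 5) * U_norm \<Omega> w * U_norm \<Omega> z"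
proof -
  obtain u \<sigma> l where ueq: "w = (u, \<sigma>, l)" by (cases w)
  obtain v \<tau> m where veq: "z = (v, \<tau>, m)" by (cases z)
  note s = uU[unfolded ueq] and t = vU[unfolded veq]
  note sL = U_memberD[OF s] and tL = U_memberD[OF t]
  let ?X = "U_norm \<Omega> (u, \<sigma>, l)" and ?Y = "U_norm \<Omega> (v, \<tau>, m)"
  let ?D = "L2_inner \<Omega> (div_plus \<Omega> \<sigma> l) (div_plus \<Omega> \<tau> m)"
  let ?G = "L2_inner \<Omega> (\<lambda>x. grad \<Omega> u x - \<sigma> x) (\<lambda>x. grad \<Omega> v x - \<tau> x)"
  have "\<bar>?D\<bar> \<le> ?X * ?Y"
    using sL tL by (intro order_trans[OF L2_Cauchy_Schwarz] mult_mono U_norm_component_le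
        L2_norm_nonneg U_norm_nonneg)
  then have D: "\<bar>\<beta> * ?D\<bar> \<le> \<beta> * (?X * ?Y)"
    using \<beta> by (simp add: abs_mult)
  have dX: "L2_norm \<Omega> (\<lambda>x. grad \<Omega> u x - \<sigma> x) \<le> 2 * ?X"
    using L2_norm_diff_le[OF sL(3,4)] U_norm_component_le(1,2)[of \<Omega>] by (smt (verit))
  have dY: "L2_norm \<Omega> (\<lambda>x. grad \<Omega> v x - \<tau> x) \<le> 2 * ?Y"
    using L2_norm_diff_le[OF tL(3,4)] U_norm_component_le(1,2)[of \<Omega>] by (smt (verit))
  have "\<bar>?G\<bar> \<le> (2 * ?X) * (2 * ?Y)"
    using sL tL dX dY by (intro order_trans[OF L2_Cauchy_Schwarz] mult_mono L2_diff
        L2_norm_nonneg) (simp_all add: U_norm_nonneg)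
  then have G: "\<bar>?G\<bar> \<le> 4 * (?X * ?Y)" by simp
  have l: "\<bar>l v\<bar> \<le> (K + 1) * (?X * ?Y)"
    by (rule U_functional_le[OF F K s t])
  have m: "\<bar>m u\<bar> \<le> (K + 1) * (?X * ?Y)"
    using U_functional_le[OF F K t s] by (simp add: mult_ac)
  \<comment> \<open>The forms differ only in the duality term; that of \<open>a_form\<close> is the mean of the other two.\<close>
  have h: "\<bar>1 / 2 * (m u + l v)\<bar> \<le> (K + 1) * (?X * ?Y)"
    using l m by (simp add: abs_le_iff)
  define E where "E = A w z - (\<beta> * ?D + ?G)"
  have "E \<in> {1 / 2 * (m u + l v), l v, m u}"
    using A unfolding E_def ueq veq by (auto simp: a_form_def b_form_def c_form_def)
  then have E: "\<bar>E\<bar> \<le> (K + 1) * (?X * ?Y)"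
    using l m h by blast
  have Aeq: "A w z = \<beta> * ?D + ?G + E" by (simp add: E_def)
  have "\<bar>A w z\<bar> \<le> \<bar>\<beta> * ?D\<bar> + \<bar>?G\<bar> + \<bar>E\<bar>"
    unfolding Aeq by (intro order_trans[OF abs_triangle_ineq] add_right_mono abs_triangle_ineq)
  also have "\<dots> \<le> \<beta> * (?X * ?Y) + 4 * (?X * ?Y) + (K + 1) * (?X * ?Y)"
    by (intro add_mono D G E)
  finally show ?thesis
    unfolding ueq veq by (simp add: algebra_simps)
qed

theorem forms_coercive:
  fixes \<Omega> :: "'a::euclidean_space set"
  assumes F: "\<And>v. v \<in> H10 \<Omega> \<Longrightarrow> L2_norm \<Omega> v \<le> K * L2_norm \<Omega> (grad \<Omega> v)"
    and \<beta>: "1 + K\<^sup>2 \<le> \<beta>" and A: "A \<in> {a_form \<Omega> \<beta>, b_form \<Omega> \<beta>, c_form \<Omega> \<beta>}" and uU: "w \<in> U \<Omega>"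
  shows "1 / 4 * (U_norm \<Omega> w)\<^sup>2 \<le> A w w"
proof -
  obtain u \<sigma> l where ueq: "w = (u, \<sigma>, l)" by (cases w)
  note s = uU[unfolded ueq]
  note sL = U_memberD[OF s]
  define f where "f = div_plus \<Omega> \<sigma> l"
  define g r d where "g = L2_norm \<Omega> (grad \<Omega> u)" and "r = L2_norm \<Omega> \<sigma>" and "d = L2_norm \<Omega> f"
  define p where "p = L2_inner \<Omega> (grad \<Omega> u) \<sigma>"
  have Aeq: "A w w = \<beta> * d\<^sup>2 + (g\<^sup>2 - p + r\<^sup>2) + L2_inner \<Omega> f u"
    using A U_functional_eq[OF s sL(1)] L2_norm_diff_power2[OF sL(3,4)] unfolding ueq
    by (auto simp: a_form_def b_form_def c_form_def f_def g_def r_def d_def p_def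
        L2_norm_power2[symmetric] L2_inner_commute[of \<Omega> \<sigma>])
  \<comment> \<open>The duality term contributes \<open>p\<close> and so cancels one of the two copies of \<open>- p\<close> in the square
    of \<open>norm (grad \<Omega> u - \<sigma>)\<close>; half of the squares then suffices to absorb the other.\<close>
  have "\<bar>p\<bar> \<le> g * r"
    unfolding p_def g_def r_def by (rule L2_Cauchy_Schwarz[OF sL(3,4)])
  moreover have "2 * (g * r) \<le> g\<^sup>2 + r\<^sup>2"
    using sum_squares_bound[of g r] by simp
  ultimately have "2 * p \<le> g\<^sup>2 + r\<^sup>2" by (simp add: abs_le_iff)
  then have P: "(g\<^sup>2 + r\<^sup>2) / 2 \<le> g\<^sup>2 - p + r\<^sup>2" by (simp add: field_simps)
  have "\<bar>L2_inner \<Omega> f u\<bar> \<le> d * L2_norm \<Omega> u"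
    unfolding d_def f_def by (rule L2_Cauchy_Schwarz[OF sL(5,2)])
  also have "\<dots> \<le> d * (K * g)"
    unfolding d_def g_def by (intro mult_left_mono F sL L2_norm_nonneg)
  also have "\<dots> \<le> K\<^sup>2 * d\<^sup>2 + g\<^sup>2 / 4"
    using sum_squares_bound[of "K * d" "g / 2"] by (simp add: power2_eq_square mult_ac)
  finally have Y: "- (K\<^sup>2 * d\<^sup>2 + g\<^sup>2 / 4) \<le> L2_inner \<Omega> f u" by linarith
  have B: "(1 + K\<^sup>2) * d\<^sup>2 \<le> \<beta> * d\<^sup>2" using \<beta> by (intro mult_right_mono) auto
  have N: "(U_norm \<Omega> w)\<^sup>2 = g\<^sup>2 + r\<^sup>2 + d\<^sup>2"
    unfolding ueq by (simp add: U_norm_def g_def r_def d_def f_def)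
  have "0 \<le> r\<^sup>2" "0 \<le> d\<^sup>2" by simp_all
  moreover have "(1 + K\<^sup>2) * d\<^sup>2 = d\<^sup>2 + K\<^sup>2 * d\<^sup>2" by (simp add: distrib_right)
  moreover have "0 \<le> g\<^sup>2" by simp
  ultimately show ?thesis
    using P Y B unfolding Aeq N by argo
qed

corollary polyhedral_forms_bounded:
  fixes \<Omega> :: "'a::euclidean_space set"
  assumes "polyhedral_lipschitz_domain \<Omega>" and \<beta>: "0 < \<beta>"
  shows "\<exists>C>0. \<forall>A \<in> {a_form \<Omega> \<beta>, b_form \<Omega> \<beta>, c_form \<Omega> \<beta>}.
    \<forall>u\<in>U \<Omega>. \<forall>v\<in>U \<Omega>. \<bar>A u v\<bar> \<le> C * U_norm \<Omega> u * U_norm \<Omega> v"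
proof -
  have bd: "bounded \<Omega>" and op: "open \<Omega>"
    using assms by (auto simp: polyhedral_lipschitz_domain_def)
  obtain R where R: "0 < R" "\<And>x. x \<in> \<Omega> \<Longrightarrow> norm x \<le> R"
    using bd by (auto simp: bounded_pos)
  have "0 \<le> 2 * R" using R by simp
  note bound = forms_bounded[OF H10_Friedrichs[OF bd op less_imp_le[OF R(1)] R(2)] this \<beta>]
  show ?thesis
    by (rule exI[of _ "\<beta> + 2 * R + 5"]) (use bound R \<beta> in auto)
qed

corollary friedrichs_constant_forms_coercive:
  fixes \<Omega> :: "'a::euclidean_space set"
  assumes "friedrichs_constant \<Omega> C" "1 + C\<^sup>2 \<le> \<beta>"
    and "A \<in> {a_form \<Omega> \<beta>, b_form \<Omega> \<beta>, c_form \<Omega> \<beta>}" "w \<in> U \<Omega>"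
  shows "1 / 4 * (U_norm \<Omega> w)\<^sup>2 \<le> A w w"
  using assms by (intro forms_coercive[of \<Omega> C]) (simp_all add: friedrichs_constant_def)

theorem lemma3:
  shows
    "(\<forall>\<Omega> :: (real^2) set. polyhedral_lipschitz_domain \<Omega> \<longrightarrow>
        (\<forall>\<beta>>0. \<exists>C\<^sub>\<beta>>0. \<forall>A \<in> {a_form \<Omega> \<beta>, b_form \<Omega> \<beta>, c_form \<Omega> \<beta>}.
           \<forall>u\<in>U \<Omega>. \<forall>v\<in>U \<Omega>. \<bar>A u v\<bar> \<le> C\<^sub>\<beta> * U_norm \<Omega> u * U_norm \<Omega> v)) \<and>
     (\<forall>\<Omega> :: (real^3) set. polyhedral_lipschitz_domain \<Omega> \<longrightarrow>
        (\<forall>\<beta>>0. \<exists>C\<^sub>\<beta>>0. \<forall>A \<in> {a_form \<Omega> \<beta>, b_form \<Omega> \<beta>, c_form \<Omega> \<beta>}.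
           \<forall>u\<in>U \<Omega>. \<forall>v\<in>U \<Omega>. \<bar>A u v\<bar> \<le> C\<^sub>\<beta> * U_norm \<Omega> u * U_norm \<Omega> v)) \<and>
     (\<exists>C>0.
        (\<forall>\<Omega> :: (real^2) set. polyhedral_lipschitz_domain \<Omega> \<longrightarrow>
           (\<forall>C\<^sub>F. friedrichs_constant \<Omega> C\<^sub>F \<longrightarrow>
              (\<forall>\<beta>>0. \<beta> \<ge> 1 + C\<^sub>F\<^sup>2 \<longrightarrow>
                 (\<forall>A \<in> {a_form \<Omega> \<beta>, b_form \<Omega> \<beta>, c_form \<Omega> \<beta>}.
                    \<forall>u\<in>U \<Omega>. C * (U_norm \<Omega> u)\<^sup>2 \<le> A u u)))) \<and>
        (\<forall>\<Omega> :: (real^3) set. polyhedral_lipschitz_domain \<Omega> \<longrightarrow>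
           (\<forall>C\<^sub>F. friedrichs_constant \<Omega> C\<^sub>F \<longrightarrow>
              (\<forall>\<beta>>0. \<beta> \<ge> 1 + C\<^sub>F\<^sup>2 \<longrightarrow>
                 (\<forall>A \<in> {a_form \<Omega> \<beta>, b_form \<Omega> \<beta>, c_form \<Omega> \<beta>}.
                    \<forall>u\<in>U \<Omega>. C * (U_norm \<Omega> u)\<^sup>2 \<le> A u u)))))"
  by (intro conjI allI impI ballI polyhedral_forms_bounded exI[of _ "1 / 4"]
      friedrichs_constant_forms_coercive) simp_all

end
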